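(* Let $B_2^n$ denote the Euclidean unit ball in $\mathbb{R}^n$ and $e_1$ the first standard basis vector. For every fixed $r\in(0,1)$ there exist constants $c_1(r),c_2(r)>0$, depending only on $r$, such that for every $n\ge 1$ $$\frac{c_1(r)}{\sqrt n}\,e^{-\Lambda_{B_2^n}^*(re_1)}\ \leq\ q_{B_2^n}(re_1)\ \leq\ \frac{c_2(r)}{\sqrt n}\,e^{-\Lambda_{B_2^n}^*(re_1)}.$$
   Context: $\mu_K$ is the uniform probability measure on a convex body $K\subseteq\mathbb{R}^n$. $\Lambda_K^*(x)=\sup_{\theta\in\mathbb{R}^n}\{\langle\theta,x\rangle-\log\int e^{\langle\theta,y\rangle}\,d\mu_K(y)\}$ is the Cramér transform of $\mu_K$, and $q_K(x)=\inf\{\mu_K(H): H\text{ a closed half-space containing }x\}$ is Tukey's half-space depth. *)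

theory Defs
  imports "HOL-Analysis.Analysis"
begin

(* The constants of the theorem must not depend on the dimension n, so n has to be
   quantified inside the formula and cannot be the cardinality of an index type.  Vectors
   of R^n are therefore functions nat => real that are extensional on {1..n}; this is
   exactly the space of the product measure lebesgue_Rn n. *)

definition Rn :: "nat \<Rightarrow> (nat \<Rightarrow> real) set" where
  "Rn n = (\<Pi>\<^sub>E i\<in>{1..n}. UNIV)"

definition inner_Rn :: "nat \<Rightarrow> (nat \<Rightarrow> real) \<Rightarrow> (nat \<Rightarrow> real) \<Rightarrow> real" where
  "inner_Rn n x y = (\<Sum>i\<in>{1..n}. x i * y i)"

definition zero_Rn :: "nat \<Rightarrow> nat \<Rightarrow> real" where
  "zero_Rn n = (\<lambda>i\<in>{1..n}. 0)"

definition scale_Rn :: "nat \<Rightarrow> real \<Rightarrow> (nat \<Rightarrow> real) \<Rightarrow> nat \<Rightarrow> real" where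
  "scale_Rn n c x = (\<lambda>i\<in>{1..n}. c * x i)"

definition e1 :: "nat \<Rightarrow> nat \<Rightarrow> real" where
  "e1 n = (\<lambda>i\<in>{1..n}. if i = 1 then 1 else 0)"

definition unit_ball :: "nat \<Rightarrow> (nat \<Rightarrow> real) set" where
  "unit_ball n = {x \<in> Rn n. L2_set x {1..n} \<le> 1}"

definition lebesgue_Rn :: "nat \<Rightarrow> (nat \<Rightarrow> real) measure" where
  "lebesgue_Rn n = Pi\<^sub>M {1..n} (\<lambda>_. lborel)"

definition mu :: "nat \<Rightarrow> (nat \<Rightarrow> real) set \<Rightarrow> (nat \<Rightarrow> real) measure" where
  "mu n K = uniform_measure (lebesgue_Rn n) K"

(* For a convex body K (compact, nonempty interior) the integral below is finite and
   positive, so neither the integral nor ln takes a default value.  The supremum is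
   infinite for x outside K, hence the type ereal. *)
definition cramer :: "nat \<Rightarrow> (nat \<Rightarrow> real) set \<Rightarrow> (nat \<Rightarrow> real) \<Rightarrow> ereal" where
  "cramer n K x =
     (SUP \<theta>\<in>Rn n. ereal (inner_Rn n \<theta> x - ln (\<integral>y. exp (inner_Rn n \<theta> y) \<partial>mu n K)))"

definition exp_ereal :: "ereal \<Rightarrow> ereal" where
  "exp_ereal x = (case x of ereal t \<Rightarrow> ereal (exp t) | PInfty \<Rightarrow> \<infinity> | MInfty \<Rightarrow> 0)"

definition closed_halfspace :: "nat \<Rightarrow> (nat \<Rightarrow> real) set \<Rightarrow> bool" where
  "closed_halfspace n H \<longleftrightarrow>
     (\<exists>u\<in>Rn n. \<exists>t. u \<noteq> zero_Rn n \<and> H = {y \<in> Rn n. inner_Rn n u y \<ge> t})"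

(* A real infimum: for n >= 1 and x in Rn n the set of values is nonempty, and it is
   bounded below by 0.  (R^0 has no half-spaces.) *)
definition tukey_depth :: "nat \<Rightarrow> (nat \<Rightarrow> real) set \<Rightarrow> (nat \<Rightarrow> real) \<Rightarrow> real" where
  "tukey_depth n K x = (INF H\<in>{H. closed_halfspace n H \<and> x \<in> H}. measure (mu n K) H)"

end

theory Submission
  imports Defs
begin

text \<open>
  Write \<open>k = n - 1\<close>.  Under the uniform measure on the ball the first coordinate has density
  proportional to \<open>w t = (1 - t\<^sup>2)\<^bsup>k/2\<^esup>\<close> on \<open>[-1, 1]\<close>, and the total mass of \<open>w\<close> is of order
  \<open>1 / sqrt n\<close>.  Everything is expressed through \<open>w r\<close>: the depth of \<open>r e\<^sub>1\<close> is of order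
  \<open>w r / sqrt n\<close>, whereas \<open>exp (- \<Lambda>\<^sup>*(r e\<^sub>1))\<close> is of order \<open>w r\<close>.

  The depth is, up to a factor of two, the measure of the cap \<open>{y. y\<^sub>1 \<ge> r}\<close>.  Rotation invariance
  would give equality, but invariance under sign changes of the coordinates already suffices
  (\<open>measure_cap_le_halfspace\<close>).  The cap has measure of order
  \<open>(w r / n) / (1 / sqrt n)\<close>, because \<open>t \<cdot> w t\<close> has an explicit antiderivative
  (\<open>integral_id_slice_weight\<close>).

  Averaging over the reflection in the first axis shows that the supremum defining \<open>\<Lambda>\<^sup>*(r e\<^sub>1)\<close> may be restricted to the first
  axis (\<open>mgf_unit_ball_ge_axis\<close>), so that \<open>exp (- \<Lambda>\<^sup>*(r e\<^sub>1))\<close> is the infimum over \<open>s\<close> of the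
  normalised integrals of \<open>exp (s (t - r)) \<cdot> w t\<close>.  These are estimated by Laplace's method.  Near
  \<open>r\<close> the function \<open>ln w\<close> agrees with its tangent up to a bounded error on a window of width
  \<open>1 / sqrt n\<close>, which gives a lower bound for every \<open>s\<close> (\<open>integral_exp_slice_weight_ge\<close>); and
  \<open>ln w\<close> lies below its tangent by at least \<open>k (t - r)\<^sup>2 / 2\<close>, which gives a matching upper bound
  for the tilt \<open>s\<close> that cancels the slope (\<open>integral_exp_slice_weight_le\<close>).  Both bounds are of
  order \<open>w r / sqrt n\<close>, and the factor \<open>1 / sqrt n\<close> disappears on normalising.
\<close>

section \<open>The marginal weight of the first coordinate\<close>

text \<open>
  For \<open>k = n - 1\<close> this is the volume of the slice of the unit ball of \<open>\<real>\<^sup>n\<close> at height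
  \<open>t\<close>, divided by the volume of the unit ball of \<open>\<real>\<^sup>k\<close>.  For \<open>\<bar>t\<bar> > 1\<close> the square root is that of a
  negative number, so the formula is meaningful on \<open>[-1, 1]\<close> only.
\<close>

definition slice_weight :: "nat \<Rightarrow> real \<Rightarrow> real" where
  "slice_weight k t = sqrt (1 - t\<^sup>2) ^ k"

definition slice_mass :: "nat \<Rightarrow> real" where
  "slice_mass k = integral {-1..1} (slice_weight k)"

lemma continuous_on_slice_weight [continuous_intros]:
  "continuous_on A (slice_weight k)"
  unfolding slice_weight_def by (intro continuous_intros)

lemma slice_weight_nonneg: "\<bar>t\<bar> \<le> 1 \<Longrightarrow> 0 \<le> slice_weight k t"
  by (simp add: slice_weight_def abs_square_le_1)

lemma slice_weight_pos: "\<bar>t\<bar> < 1 \<Longrightarrow> 0 < slice_weight k t"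
  by (simp add: slice_weight_def abs_square_less_1)

text \<open>
  Expansion of \<open>1 - t\<^sup>2\<close> around \<open>r\<close>, relative to its value there: both exponential bounds on
  the weight come from bounding the second factor.
\<close>

lemma slice_weight_factor:
  fixes r t :: real
  assumes "0 \<le> r" "r < 1"
  shows "1 - t\<^sup>2 = (1 - r\<^sup>2) * (1 - (2 * r * (t - r) + (t - r)\<^sup>2) / (1 - r\<^sup>2))"
proof -
  have "r\<^sup>2 < 1" using assms by (simp add: abs_square_less_1)
  then have "(1 - r\<^sup>2) * (1 - X / (1 - r\<^sup>2)) = 1 - r\<^sup>2 - X" for X
    by (simp add: right_diff_distrib)
  then show ?thesis by (simp only:) (simp add: algebra_simps power2_eq_square)
qed

lemma sqrt_mult_exp: "sqrt (c * exp x) = sqrt c * exp (x / 2)"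
proof -
  have "sqrt (exp x) = exp (x / 2)"
    by (rule real_sqrt_unique) (auto simp: exp_double[symmetric])
  then show ?thesis by (simp add: real_sqrt_mult)
qed

text \<open>
  The logarithm of \<open>1 - t\<^sup>2\<close> has second derivative at most \<open>-2\<close>, hence lies below its tangent
  at \<open>r\<close> by at least \<open>(t - r)\<^sup>2\<close>.  In the factorised form this is just \<open>1 - x \<le> exp (- x)\<close>.
\<close>

lemma slice_weight_le_gaussian:
  fixes r t :: real
  assumes r: "0 \<le> r" "r < 1" and t: "\<bar>t\<bar> \<le> 1"
  shows "slice_weight k t
    \<le> slice_weight k r * exp (- (real k * (r / (1 - r\<^sup>2)) * (t - r)) - real k * (t - r)\<^sup>2 / 2)"
proof -
  have collect: "real k * ((- (2 * a * h) - h\<^sup>2) / 2) = - (real k * a * h) - real k * h\<^sup>2 / 2"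
    for a h :: real by (simp add: field_simps)
  define h where "h = t - r"
  define y where "y = - (2 * (r / (1 - r\<^sup>2)) * h) - h\<^sup>2"
  have r2: "0 < 1 - r\<^sup>2" "1 - r\<^sup>2 \<le> 1" using r by (simp_all add: abs_square_less_1)
  have "h\<^sup>2 * (1 - r\<^sup>2) \<le> h\<^sup>2 * 1" using r2 by (intro mult_left_mono) auto
  then have "h\<^sup>2 \<le> h\<^sup>2 / (1 - r\<^sup>2)" using r2 by (simp add: field_simps)
  then have "- ((2 * r * h + h\<^sup>2) / (1 - r\<^sup>2)) \<le> y"
    unfolding y_def by (simp add: add_divide_distrib)
  then have "1 - (2 * r * h + h\<^sup>2) / (1 - r\<^sup>2) \<le> exp y"
    using exp_ge_add_one_self[of y] by linarith
  then have "1 - t\<^sup>2 \<le> (1 - r\<^sup>2) * exp y"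
    unfolding slice_weight_factor[OF r, of t] h_def using r2 by (intro mult_left_mono) auto
  then have "sqrt (1 - t\<^sup>2) \<le> sqrt (1 - r\<^sup>2) * exp (y / 2)"
    unfolding sqrt_mult_exp[symmetric] by simp
  then have "sqrt (1 - t\<^sup>2) ^ k \<le> (sqrt (1 - r\<^sup>2) * exp (y / 2)) ^ k"
    using t by (intro power_mono) (auto simp: abs_square_le_1)
  also have "\<dots> = slice_weight k r * exp (real k * (y / 2))"
    by (simp only: power_mult_distrib slice_weight_def exp_of_nat_mult)
  also have "real k * (y / 2) = - (real k * (r / (1 - r\<^sup>2)) * (t - r)) - real k * (t - r)\<^sup>2 / 2"
    unfolding y_def h_def by (rule collect)
  finally show ?thesis by (simp add: slice_weight_def)
qed

text \<open>
  On a window of width of order \<open>1 / sqrt n\<close> the quadratic correction to the tangent of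
  \<open>ln (1 - t\<^sup>2)\<close> is of order \<open>1 / n\<close>, so its \<open>k\<close>-fold multiple stays bounded and costs only a
  constant factor.  The width is chosen so that the relative increment \<open>x\<close> below satisfies
  \<open>\<bar>x\<bar> \<le> 1 / (2 sqrt n)\<close>.
\<close>

lemma slice_weight_ge_exponential:
  fixes r t :: real
  assumes r: "0 \<le> r" "r < 1" and n: "n = Suc k"
    and t: "\<bar>t - r\<bar> \<le> (1 - r\<^sup>2) / (6 * sqrt (real n))"
  shows "slice_weight k r * exp (- (real k * (r / (1 - r\<^sup>2)) * (t - r))) * exp (- (1 / 2))
    \<le> slice_weight k t"
proof -
  define h where "h = t - r"
  define x where "x = (2 * r * h + h\<^sup>2) / (1 - r\<^sup>2)"
  define y where "y = - (2 * (r / (1 - r\<^sup>2)) * h) - 1 / real n"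
  have r2: "0 < 1 - r\<^sup>2" "1 - r\<^sup>2 \<le> 1" using r by (simp_all add: abs_square_less_1)
  have sn: "1 \<le> sqrt (real n)" using n by simp
  have sn6: "1 \<le> 6 * sqrt (real n)" using sn by linarith
  have h: "\<bar>h\<bar> \<le> (1 - r\<^sup>2) / (6 * sqrt (real n))" using t by (simp add: h_def)
  then have h2: "\<bar>h\<bar> / (1 - r\<^sup>2) \<le> 1 / (6 * sqrt (real n))"
    using r2 by (simp add: field_simps)
  have h3: "\<bar>h\<bar> \<le> 1 / (6 * sqrt (real n))"
    using h r2 sn by (smt (verit) divide_right_mono mult_nonneg_nonneg)
  also have "\<dots> \<le> 1" using sn6 by (simp add: divide_le_eq)
  finally have h1: "\<bar>h\<bar> \<le> 1" .
  have "\<bar>2 * r * h + h\<^sup>2\<bar> = \<bar>h\<bar> * \<bar>2 * r + h\<bar>"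
    by (simp add: abs_mult[symmetric] algebra_simps power2_eq_square)
  also have "\<dots> \<le> \<bar>h\<bar> * 3" using h1 r by (intro mult_left_mono) auto
  finally have "\<bar>x\<bar> \<le> 3 * (\<bar>h\<bar> / (1 - r\<^sup>2))"
    unfolding x_def using r2 divide_right_mono[of "\<bar>2 * r * h + h\<^sup>2\<bar>" "\<bar>h\<bar> * 3" "1 - r\<^sup>2"]
    by (simp add: abs_divide mult.commute)
  then have x: "\<bar>x\<bar> \<le> 1 / (2 * sqrt (real n))" using h2 by (simp add: field_simps)
  also have "\<dots> \<le> 1 / 2" using sn by (simp add: field_simps)
  finally have x1: "\<bar>x\<bar> \<le> 1 / 2" .
  have "x\<^sup>2 \<le> (1 / (2 * sqrt (real n)))\<^sup>2"
    using x by (metis abs_ge_zero power2_abs power_mono)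
  then have x2: "x\<^sup>2 \<le> 1 / (4 * real n)" using n by (simp add: power_divide power_mult_distrib)
  have "h\<^sup>2 / (1 - r\<^sup>2) = \<bar>h\<bar> * (\<bar>h\<bar> / (1 - r\<^sup>2))" by (simp add: power2_eq_square)
  also have "\<dots> \<le> 1 / (6 * sqrt (real n)) * (1 / (6 * sqrt (real n)))"
    using h2 h3 r2 sn by (intro mult_mono) auto
  also have "\<dots> \<le> 1 / (2 * real n)" using n by (simp add: field_simps)
  finally have h4: "h\<^sup>2 / (1 - r\<^sup>2) \<le> 1 / (2 * real n)" .
  have "\<bar>ln (1 + (- x)) - (- x)\<bar> \<le> 2 * (- x)\<^sup>2"
    by (rule abs_ln_one_plus_x_minus_x_bound) (use x1 in auto)
  then have "- x - 2 * x\<^sup>2 \<le> ln (1 - x)" by simp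
  moreover have "y \<le> - x - 2 * x\<^sup>2"
  proof -
    have "x = 2 * (r / (1 - r\<^sup>2)) * h + h\<^sup>2 / (1 - r\<^sup>2)" by (simp add: x_def add_divide_distrib)
    moreover have "2 * x\<^sup>2 \<le> 1 / (2 * real n)" using x2 by simp
    moreover have "1 / (2 * real n) + 1 / (2 * real n) = 1 / real n" by simp
    ultimately show ?thesis using h4 unfolding y_def by linarith
  qed
  ultimately have "exp y \<le> exp (ln (1 - x))" by simp
  then have "exp y \<le> 1 - x" using x1 by (subst (asm) exp_ln) auto
  then have "(1 - r\<^sup>2) * exp y \<le> 1 - t\<^sup>2"
    unfolding slice_weight_factor[OF r, of t] x_def h_def using r2 by (intro mult_left_mono) auto
  then have "sqrt (1 - r\<^sup>2) * exp (y / 2) \<le> sqrt (1 - t\<^sup>2)"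
    unfolding sqrt_mult_exp[symmetric] by simp
  then have "(sqrt (1 - r\<^sup>2) * exp (y / 2)) ^ k \<le> sqrt (1 - t\<^sup>2) ^ k"
    using r2 by (intro power_mono) auto
  moreover have "(sqrt (1 - r\<^sup>2) * exp (y / 2)) ^ k = slice_weight k r * exp (real k * (y / 2))"
    by (simp only: power_mult_distrib slice_weight_def exp_of_nat_mult)
  moreover have "- (real k * (r / (1 - r\<^sup>2)) * h) + - (1 / 2) \<le> real k * (y / 2)"
    using n by (simp add: y_def field_simps)
  then have "slice_weight k r * exp (- (real k * (r / (1 - r\<^sup>2)) * h) + - (1 / 2))
      \<le> slice_weight k r * exp (real k * (y / 2))"
    using r by (intro mult_left_mono) (auto intro!: slice_weight_nonneg)
  ultimately have "slice_weight k r * exp (- (real k * (r / (1 - r\<^sup>2)) * h) + - (1 / 2)) \<le> slice_weight k t"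
    by (simp only: slice_weight_def[of k t])
  then show ?thesis by (simp only: h_def exp_add mult.assoc)
qed

text \<open>
  The window around \<open>r\<close> is symmetric.  On it the integrand dominates a multiple of
  \<open>exp (c (t - r)) \<ge> 1 + c (t - r)\<close>, whose linear part integrates to \<open>0\<close>; therefore the bound does
  not depend on the tilt \<open>s\<close>.
\<close>

lemma integral_exp_slice_weight_ge:
  fixes r s :: real
  assumes r: "0 \<le> r" "r < 1" and n: "n = Suc k"
  shows "(1 - r\<^sup>2) / 3 * exp (- (1 / 2)) * slice_weight k r / sqrt (real n)
    \<le> integral {-1..1} (\<lambda>t. exp (s * (t - r)) * slice_weight k t)"
proof -
  define d where "d = (1 - r\<^sup>2) / (6 * sqrt (real n))"
  define c where "c = s - real k * (r / (1 - r\<^sup>2))"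
  define A where "A = slice_weight k r * exp (- (1 / 2))"
  have r2: "0 < 1 - r\<^sup>2" using r by (simp_all add: abs_square_less_1)
  have sn: "1 \<le> sqrt (real n)" using n by simp
  have d0: "0 < d" using r2 sn by (auto simp: d_def)
  have "d \<le> (1 - r\<^sup>2) / 6" unfolding d_def using r2 sn by (intro divide_left_mono) auto
  also have "1 - r\<^sup>2 = (1 - r) * (1 + r)" by (simp add: algebra_simps power2_eq_square)
  also have "(1 - r) * (1 + r) \<le> (1 - r) * 2" using r by (intro mult_left_mono) auto
  finally have d1: "d \<le> 1 - r" using r by simp
  have sub: "{r - d..r + d} \<subseteq> {-1..1}" using d1 r by auto
  have A0: "0 \<le> A" using r by (auto simp: A_def intro!: slice_weight_nonneg mult_nonneg_nonneg)
  have "((\<lambda>t. A * (1 + c * (t - r))) has_integral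
      A * ((r + d) + c * ((r + d) - r)\<^sup>2 / 2) - A * ((r - d) + c * ((r - d) - r)\<^sup>2 / 2)) {r - d..r + d}"
    by (rule fundamental_theorem_of_calculus)
      (use d0 in \<open>auto simp: has_real_derivative_iff_has_vector_derivative[symmetric]
         intro!: derivative_eq_intros\<close>)
  then have int1: "((\<lambda>t. A * (1 + c * (t - r))) has_integral A * (2 * d)) {r - d..r + d}"
    by (simp add: algebra_simps)
  have "A * (2 * d) = integral {r - d..r + d} (\<lambda>t. A * (1 + c * (t - r)))"
    using integral_unique[OF int1] by (rule sym)
  also have "\<dots> \<le> integral {r - d..r + d} (\<lambda>t. exp (s * (t - r)) * slice_weight k t)"
  proof (rule integral_le)
    fix t assume "t \<in> {r - d..r + d}"
    then have "\<bar>t - r\<bar> \<le> (1 - r\<^sup>2) / (6 * sqrt (real n))" by (auto simp: d_def)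
    from slice_weight_ge_exponential[OF r n this]
    have *: "exp (s * (t - r)) * (A * exp (- (real k * (r / (1 - r\<^sup>2)) * (t - r))))
      \<le> exp (s * (t - r)) * slice_weight k t"
      by (intro mult_left_mono) (auto simp: A_def mult_ac)
    have "c * (t - r) = s * (t - r) + - (real k * (r / (1 - r\<^sup>2)) * (t - r))"
      by (simp add: c_def left_diff_distrib)
    then have "exp (c * (t - r)) = exp (s * (t - r)) * exp (- (real k * (r / (1 - r\<^sup>2)) * (t - r)))"
      by (simp only: exp_add)
    moreover have "A * (1 + c * (t - r)) \<le> A * exp (c * (t - r))"
      using A0 by (intro mult_left_mono) auto
    ultimately show "A * (1 + c * (t - r)) \<le> exp (s * (t - r)) * slice_weight k t"
      using * by (simp only: mult_ac)
  qed (auto intro!: integrable_continuous_interval continuous_intros)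
  also have "\<dots> \<le> integral {-1..1} (\<lambda>t. exp (s * (t - r)) * slice_weight k t)"
    using sub by (intro integral_subset_le)
      (auto intro!: integrable_continuous_interval continuous_intros mult_nonneg_nonneg
         slice_weight_nonneg)
  finally have "A * (2 * d) \<le> integral {-1..1} (\<lambda>t. exp (s * (t - r)) * slice_weight k t)" .
  moreover have "A * (2 * d) = (1 - r\<^sup>2) / 3 * exp (- (1 / 2)) * slice_weight k r / sqrt (real n)"
    unfolding A_def d_def using sn by (simp add: field_simps)
  ultimately show ?thesis by (simp only:)
qed

text \<open>
  The tilt \<open>s = k r / (1 - r\<^sup>2)\<close> cancels the slope of \<open>k / 2 \<cdot> ln (1 - t\<^sup>2)\<close> at \<open>r\<close>, which leaves a
  Gaussian of width of order \<open>1 / sqrt n\<close>.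
\<close>

lemma integral_exp_slice_weight_le:
  fixes r :: real
  assumes r: "0 \<le> r" "r < 1" and n: "n = Suc k"
  shows "integral {-1..1} (\<lambda>t. exp (real k * (r / (1 - r\<^sup>2)) * (t - r)) * slice_weight k t)
    \<le> exp 2 * pi * sqrt 2 * slice_weight k r / sqrt (real n)"
proof -
  define m where "m = sqrt (real n / 2)"
  define s where "s = real k * (r / (1 - r\<^sup>2))"
  define A where "A = slice_weight k r * exp 2"
  have m: "0 < m" "m\<^sup>2 = real n / 2" using n by (auto simp: m_def)
  have A0: "0 \<le> A" using r by (auto simp: A_def intro!: slice_weight_nonneg mult_nonneg_nonneg)
  have int1: "((\<lambda>t. A * (1 / (1 + (m * (t - r))\<^sup>2))) has_integral
      A * (arctan (m * (1 - r)) / m) - A * (arctan (m * (- 1 - r)) / m)) {-1..1}"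
  proof (rule fundamental_theorem_of_calculus)
    fix t :: real
    have "((\<lambda>t. A * (arctan (m * (t - r)) / m)) has_real_derivative
        A * (inverse (1 + (m * (t - r))\<^sup>2) * (m * 1) / m)) (at t within {-1..1})"
      using m by (intro DERIV_cmult DERIV_cdivide DERIV_chain2[OF DERIV_arctan]) (auto intro!: derivative_eq_intros)
    then show "((\<lambda>t. A * (arctan (m * (t - r)) / m)) has_vector_derivative
        A * (1 / (1 + (m * (t - r))\<^sup>2))) (at t within {-1..1})"
      using m by (simp add: has_real_derivative_iff_has_vector_derivative[symmetric] inverse_eq_divide)
  qed simp
  have "integral {-1..1} (\<lambda>t. exp (s * (t - r)) * slice_weight k t)
      \<le> integral {-1..1} (\<lambda>t. A * (1 / (1 + (m * (t - r))\<^sup>2)))"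
  proof (rule integral_le)
    fix t :: real assume t: "t \<in> {-1..1}"
    define h where "h = t - r"
    have "\<bar>h\<bar> \<le> 2" using t r by (auto simp: h_def)
    then have h: "h\<^sup>2 \<le> 2\<^sup>2" by (metis abs_ge_zero power2_abs power_mono)
    have "exp (s * h) * slice_weight k t
        \<le> exp (s * h) * (slice_weight k r * exp (- (s * h) - real k * h\<^sup>2 / 2))"
      using slice_weight_le_gaussian[OF r, of t k] t by (intro mult_left_mono) (auto simp: s_def h_def)
    also have "\<dots> = slice_weight k r * (exp (s * h) * exp (- (s * h) - real k * h\<^sup>2 / 2))"
      by (simp only: mult_ac)
    also have "exp (s * h) * exp (- (s * h) - real k * h\<^sup>2 / 2) = exp (- (real k * h\<^sup>2 / 2))"
      unfolding exp_add[symmetric] by simp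
    also have "slice_weight k r * exp (- (real k * h\<^sup>2 / 2)) \<le> slice_weight k r * (exp 2 * exp (- (m * h)\<^sup>2))"
    proof (rule mult_left_mono)
      \<comment> \<open>As \<open>\<bar>h\<bar> \<le> 2\<close>, the factor \<open>exp 2\<close> pays for passing from \<open>k\<close> to \<open>n = k + 1\<close> in the exponent,
        which keeps the bound meaningful when \<open>k = 0\<close>.\<close>
      have "(m * h)\<^sup>2 = real k * h\<^sup>2 / 2 + h\<^sup>2 / 2"
        unfolding power_mult_distrib m(2) using n by (simp add: field_simps)
      then show "exp (- (real k * h\<^sup>2 / 2)) \<le> exp 2 * exp (- (m * h)\<^sup>2)"
        unfolding exp_add[symmetric] using h by simp
    qed (use r in \<open>auto intro: slice_weight_nonneg\<close>)
    \<comment> \<open>The Lorentzian replaces the Gaussian because its antiderivative is explicit.\<close>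
    also have "exp (- (m * h)\<^sup>2) \<le> 1 / (1 + (m * h)\<^sup>2)"
      using exp_ge_add_one_self[of "(m * h)\<^sup>2"]
      by (simp add: exp_minus inverse_eq_divide divide_left_mono add_pos_nonneg)
    finally show "exp (s * (t - r)) * slice_weight k t \<le> A * (1 / (1 + (m * (t - r))\<^sup>2))"
      using r by (simp add: A_def h_def mult_left_mono slice_weight_nonneg)
  qed (use int1 in \<open>auto intro!: integrable_continuous_interval continuous_intros
       simp: integrable_on_def\<close>)
  also have "\<dots> = A * (arctan (m * (1 - r)) - arctan (m * (- 1 - r))) / m"
    using int1 m by (simp add: integral_unique field_simps)
  also have "\<dots> \<le> A * pi / m"
    using arctan_bounded[of "m * (1 - r)"] arctan_bounded[of "m * (- 1 - r)"] m A0
    by (intro divide_right_mono mult_left_mono) auto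
  also have "\<dots> = exp 2 * pi * sqrt 2 * slice_weight k r / sqrt (real n)"
    by (simp add: A_def m_def real_sqrt_divide)
  finally show ?thesis by (simp add: s_def)
qed

text \<open>
  The two preceding bounds with \<open>r = 0\<close> and \<open>s = 0\<close> determine the order of the normalising
  constant.
\<close>

lemma slice_mass_ge: "n = Suc k \<Longrightarrow> exp (- (1 / 2)) / 3 / sqrt (real n) \<le> slice_mass k"
  using integral_exp_slice_weight_ge[of 0 n k 0] by (simp add: slice_mass_def slice_weight_def[of k 0])

lemma slice_mass_le: "n = Suc k \<Longrightarrow> slice_mass k \<le> exp 2 * pi * sqrt 2 / sqrt (real n)"
  using integral_exp_slice_weight_le[of 0 n k] by (simp add: slice_mass_def slice_weight_def[of k 0])

lemma slice_mass_pos: "0 < slice_mass k"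
  using slice_mass_ge[OF refl, of k] by (rule less_le_trans[rotated]) simp

text \<open>
  With the extra factor \<open>t\<close> the weight has the elementary antiderivative
  \<open>- (1 - t\<^sup>2)\<^bsup>k/2 + 1\<^esup> / (k + 2)\<close>.  On \<open>[r, 1]\<close> this factor lies between \<open>r\<close> and \<open>1\<close>, so nothing
  but a constant is lost by inserting it.
\<close>

lemma integral_id_slice_weight:
  fixes r :: real
  assumes r: "0 \<le> r" "r < 1"
  shows "((\<lambda>t. t * slice_weight k t) has_integral (1 - r\<^sup>2) * slice_weight k r / real (k + 2)) {r..1}"
proof -
  let ?F = "\<lambda>t. - (sqrt (1 - t\<^sup>2) ^ (k + 2)) / real (k + 2)"
  have "((\<lambda>t. t * slice_weight k t) has_integral ?F 1 - ?F r) {r..1}"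
  proof (rule fundamental_theorem_of_calculus_interior)
    fix t assume "t \<in> {r<..<1}"
    then have "t\<^sup>2 < 1" using r by (simp add: abs_square_less_1)
    then have S: "sqrt (1 - t\<^sup>2) \<noteq> 0"
      and dS: "((\<lambda>t. sqrt (1 - t\<^sup>2)) has_real_derivative - t / sqrt (1 - t\<^sup>2)) (at t)"
      by (auto intro!: derivative_eq_intros simp: inverse_eq_divide)
    have "(?F has_real_derivative
        - (real (k + 2) * ((- t / sqrt (1 - t\<^sup>2)) * sqrt (1 - t\<^sup>2) ^ (k + 2 - Suc 0))) / real (k + 2)) (at t)"
      by (intro DERIV_cdivide DERIV_minus DERIV_power dS)
    moreover have "- (real (k + 2) * ((- t / sqrt (1 - t\<^sup>2)) * sqrt (1 - t\<^sup>2) ^ (k + 2 - Suc 0))) / real (k + 2)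
        = t * slice_weight k t"
    proof -
      have cancel: "- (c * (- t / u * u ^ (k + 2 - Suc 0))) / c = t * u ^ k" if "c \<noteq> 0" "u \<noteq> 0" for c u :: real
        using that by simp
      show ?thesis unfolding slice_weight_def by (rule cancel) (use S in auto)
    qed
    ultimately have "(?F has_real_derivative t * slice_weight k t) (at t)" by simp
    then show "(?F has_vector_derivative t * slice_weight k t) (at t)"
      by (simp add: has_real_derivative_iff_has_vector_derivative)
  qed (use r in \<open>auto intro!: continuous_intros\<close>)
  moreover have "?F 1 - ?F r = (1 - r\<^sup>2) * slice_weight k r / real (k + 2)"
    using r by (simp add: slice_weight_def power_add abs_square_le_1)
  ultimately show ?thesis by simp
qed

lemma integral_cap_ge:
  assumes r: "0 \<le> r" "r < 1"
  shows "(1 - r\<^sup>2) * slice_weight k r / real (k + 2) \<le> integral {r..1} (slice_weight k)"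
proof -
  have "integral {r..1} (\<lambda>t. t * slice_weight k t) \<le> integral {r..1} (slice_weight k)"
    using r by (intro integral_le)
     (auto intro!: integrable_continuous_interval continuous_intros mult_left_le_one_le slice_weight_nonneg)
  then show ?thesis using integral_id_slice_weight[OF r, of k] by (simp add: integral_unique)
qed

lemma integral_cap_le:
  assumes r: "0 < r" "r < 1"
  shows "integral {r..1} (slice_weight k) \<le> (1 - r\<^sup>2) * slice_weight k r / real (k + 2) / r"
proof -
  have "integral {r..1} (slice_weight k) \<le> integral {r..1} (\<lambda>t. (t * slice_weight k t) / r)"
  proof (rule integral_le)
    fix t assume "t \<in> {r..1}"
    then have "r * slice_weight k t \<le> t * slice_weight k t"
      using r by (intro mult_right_mono slice_weight_nonneg) auto
    then show "slice_weight k t \<le> t * slice_weight k t / r" using r by (simp add: field_simps)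
  qed (use r in \<open>auto intro!: integrable_continuous_interval continuous_intros\<close>)
  then show ?thesis using integral_id_slice_weight[of r k] r by (simp add: integral_unique)
qed

section \<open>The distribution of the first coordinate\<close>

lemma space_lebesgue_Rn [simp]: "space (lebesgue_Rn n) = Rn n"
  by (simp add: lebesgue_Rn_def Rn_def space_PiM)

lemma measurable_coord_Rn:
  "i \<in> {1..n} \<Longrightarrow> (\<lambda>y. y i) \<in> borel_measurable (lebesgue_Rn n)"
  unfolding lebesgue_Rn_def by measurable

lemma measurable_inner_Rn [measurable]: "inner_Rn n u \<in> borel_measurable (lebesgue_Rn n)"
  unfolding inner_Rn_def[abs_def] lebesgue_Rn_def by measurable

lemma unit_ball_altdef:
  "unit_ball n = {f. sqrt (\<Sum>i\<in>{1..n}. (f i)\<^sup>2) \<le> 1} \<inter> space (Pi\<^sub>M {1..n} (\<lambda>_. lborel))"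
  by (auto simp: unit_ball_def L2_set_def Rn_def space_PiM)

lemma sets_unit_ball [measurable]: "unit_ball n \<in> sets (lebesgue_Rn n)"
proof -
  have "{f \<in> space (Pi\<^sub>M {1..n} (\<lambda>_. lborel)). sqrt (\<Sum>i\<in>{1..n}. (f i)\<^sup>2) \<le> 1}
      \<in> sets (Pi\<^sub>M {1..n} (\<lambda>_. lborel :: real measure))" by measurable
  then show ?thesis by (simp add: unit_ball_altdef lebesgue_Rn_def Int_def conj_commute)
qed

lemma emeasure_unit_ball: "emeasure (lebesgue_Rn n) (unit_ball n) = ennreal (unit_ball_vol (real n))"
  using emeasure_cball_aux[of "{1..n}" 1] by (simp add: unit_ball_altdef lebesgue_Rn_def)

lemma sets_mu [simp, measurable_cong]: "sets (mu n K) = sets (lebesgue_Rn n)"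
  by (simp add: mu_def)

lemma space_mu [simp]: "space (mu n K) = Rn n"
  by (simp add: mu_def)

lemma emeasure_mu:
  "A \<in> sets (lebesgue_Rn n) \<Longrightarrow> emeasure (mu n (unit_ball n)) A
     = emeasure (lebesgue_Rn n) (unit_ball n \<inter> A) / ennreal (unit_ball_vol (real n))"
  by (simp add: mu_def emeasure_unit_ball)

lemma finite_measure_mu: "finite_measure (mu n (unit_ball n))"
proof
  have "unit_ball n \<inter> Rn n = unit_ball n" by (auto simp: unit_ball_def)
  then show "emeasure (mu n (unit_ball n)) (space (mu n (unit_ball n))) \<noteq> \<infinity>"
    using sets.top[of "lebesgue_Rn n"]
    by (simp add: emeasure_mu emeasure_unit_ball divide_ennreal)
qed

text \<open>
  Fubini in the first coordinate: the slice of the ball at height \<open>t\<close> is a ball of radius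
  \<open>sqrt (1 - t\<^sup>2)\<close> in the remaining \<open>k\<close> coordinates.
\<close>

lemma nn_integral_unit_ball_slices:
  fixes g :: "real \<Rightarrow> ennreal"
  assumes n: "n = Suc k" and g [measurable]: "g \<in> borel_measurable borel"
  shows "(\<integral>\<^sup>+y. g (y 1) * indicator (unit_ball n) y \<partial>lebesgue_Rn n)
    = ennreal (unit_ball_vol (real k))
      * (\<integral>\<^sup>+t. g t * (ennreal (slice_weight k t) * indicator {-1..1} t) \<partial>lborel)"
proof -
  interpret product_sigma_finite "\<lambda>_::nat. lborel :: real measure" by standard
  define I where "I = {2..n}"
  have I: "finite I" "1 \<notin> I" "insert 1 I = {1..n}" "card I = k" using n by (auto simp: I_def)
  define B where "B \<rho> = {f. sqrt (\<Sum>i\<in>I. (f i)\<^sup>2) \<le> \<rho>} \<inter> space (Pi\<^sub>M I (\<lambda>_. lborel :: real measure))" for \<rho>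
  have B [measurable]: "B \<rho> \<in> sets (Pi\<^sub>M I (\<lambda>_. lborel))" for \<rho>
  proof -
    have "{f \<in> space (Pi\<^sub>M I (\<lambda>_. lborel)). sqrt (\<Sum>i\<in>I. (f i)\<^sup>2) \<le> \<rho>}
      \<in> sets (Pi\<^sub>M I (\<lambda>_. lborel :: real measure))" by measurable
    then show ?thesis by (simp add: B_def Int_def conj_commute)
  qed
  have meas: "(\<lambda>y. g (y 1) * indicator (unit_ball n) y) \<in> borel_measurable (Pi\<^sub>M (insert 1 I) (\<lambda>_. lborel))"
  proof -
    have "(\<lambda>y. g (y 1) * indicator (unit_ball n) y) \<in> borel_measurable (lebesgue_Rn n)"
      using n by (intro borel_measurable_times_ennreal measurable_compose[OF measurable_coord_Rn g]
        borel_measurable_indicator sets_unit_ball) auto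
    then show ?thesis using I by (simp add: lebesgue_Rn_def)
  qed
  have slice: "indicator (unit_ball n) (x(1 := t)) = indicator {-1..1} t * (indicator (B (sqrt (1 - t\<^sup>2))) x :: ennreal)"
    if x: "x \<in> space (Pi\<^sub>M I (\<lambda>_. lborel))" for x t
  proof -
    have "(\<Sum>i\<in>I. ((x(1 := t)) i)\<^sup>2) = (\<Sum>i\<in>I. (x i)\<^sup>2)"
      using I by (intro sum.cong) auto
    then have *: "(\<Sum>i\<in>{1..n}. ((x(1 := t)) i)\<^sup>2) = t\<^sup>2 + (\<Sum>i\<in>I. (x i)\<^sup>2)"
      unfolding I(3)[symmetric] sum.insert[OF I(1,2)] by simp
    have "x(1 := t) \<in> space (Pi\<^sub>M {1..n} (\<lambda>_. lborel :: real measure))"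
      unfolding I(3)[symmetric] using x by (auto simp: space_PiM PiE_def extensional_def)
    moreover have "t\<^sup>2 + c \<le> 1 \<longleftrightarrow> t \<in> {-1..1} \<and> c \<le> 1 - t\<^sup>2" if "0 \<le> c" for c
      using that abs_square_le_1[of t] by auto
    note this[of "\<Sum>i\<in>I. (x i)\<^sup>2"]
    ultimately show ?thesis using x
      by (auto simp: indicator_def unit_ball_altdef * B_def sum_nonneg simp del: One_nat_def fun_upd_apply)
  qed
  have "(\<integral>\<^sup>+y. g (y 1) * indicator (unit_ball n) y \<partial>lebesgue_Rn n)
    = (\<integral>\<^sup>+t. (\<integral>\<^sup>+x. g t * (indicator {-1..1} t * indicator (B (sqrt (1 - t\<^sup>2))) x) \<partial>Pi\<^sub>M I (\<lambda>_. lborel)) \<partial>lborel)"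
    unfolding lebesgue_Rn_def I(3)[symmetric] using I
    by (subst product_nn_integral_insert_rev[OF _ _ meas])
      (auto intro!: nn_integral_cong simp: slice simp del: One_nat_def)
  also have "\<dots> = (\<integral>\<^sup>+t. g t * (indicator {-1..1} t * emeasure (Pi\<^sub>M I (\<lambda>_. lborel)) (B (sqrt (1 - t\<^sup>2)))) \<partial>lborel)"
    by (intro nn_integral_cong) (simp add: nn_integral_cmult mult.assoc)
  also have "\<dots> = (\<integral>\<^sup>+t. ennreal (unit_ball_vol (real k))
      * (g t * (ennreal (slice_weight k t) * indicator {-1..1} t)) \<partial>lborel)"
  proof (rule nn_integral_cong_AE)
    have "AE t in lborel. t \<notin> {-1, 1 :: real}"
      by (intro AE_not_in countable_imp_null_set_lborel) auto
    then show "AE t in lborel. g t * (indicator {-1..1} t * emeasure (Pi\<^sub>M I (\<lambda>_. lborel)) (B (sqrt (1 - t\<^sup>2))))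
      = ennreal (unit_ball_vol (real k)) * (g t * (ennreal (slice_weight k t) * indicator {-1..1} t))"
    proof eventually_elim
      case (elim t)
      show ?case
      proof (cases "t \<in> {-1<..<1}")
        case True
        then have t: "0 < sqrt (1 - t\<^sup>2)" by (simp add: abs_square_less_1 abs_less_iff)
        have "emeasure (Pi\<^sub>M I (\<lambda>_. lborel)) (B (sqrt (1 - t\<^sup>2)))
            = ennreal (unit_ball_vol (real k)) * ennreal (slice_weight k t)"
          unfolding B_def using emeasure_cball_aux[OF I(1) t] I t
          by (simp add: slice_weight_def ennreal_mult)
        then show ?thesis by (simp add: mult_ac)
      qed (use elim in \<open>auto simp: indicator_def\<close>)
    qed
  qed
  also have "\<dots> = ennreal (unit_ball_vol (real k))
      * (\<integral>\<^sup>+t. g t * (ennreal (slice_weight k t) * indicator {-1..1} t) \<partial>lborel)"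
    by (intro nn_integral_cmult) (auto simp: slice_weight_def)
  finally show ?thesis .
qed

lemma nn_integral_unit_ball_first_coord:
  assumes n: "n = Suc k" and f [measurable]: "f \<in> borel_measurable borel" and nonneg: "\<And>t. 0 \<le> f t"
    and J: "((\<lambda>t. f t * slice_weight k t) has_integral J) {-1..1}"
  shows "(\<integral>\<^sup>+y. ennreal (f (y 1)) * indicator (unit_ball n) y \<partial>lebesgue_Rn n)
    = ennreal (unit_ball_vol (real k) * J)"
proof -
  have J0: "0 \<le> J"
    using J by (rule has_integral_nonneg) (auto intro!: mult_nonneg_nonneg nonneg slice_weight_nonneg)
  have "(\<integral>\<^sup>+t. ennreal (f t) * (ennreal (slice_weight k t) * indicator {-1..1} t) \<partial>lborel)
    = (\<integral>\<^sup>+t. ennreal (f t * slice_weight k t) * indicator {-1..1} t \<partial>lborel)"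
    by (intro nn_integral_cong) (auto simp: indicator_def ennreal_mult' nonneg)
  also have "\<dots> = ennreal J"
    by (rule nn_integral_has_integral_lebesgue'[OF _ J]) (auto intro!: mult_nonneg_nonneg nonneg slice_weight_nonneg)
  finally show ?thesis
    using nn_integral_unit_ball_slices[OF n, of "\<lambda>t. ennreal (f t)"] J0 by (simp add: ennreal_mult)
qed

text \<open>
  Taking the constant function \<open>1\<close> in the slicing formula identifies the ratio of two
  consecutive ball volumes with the mass of the weight, which is therefore the normalising
  constant of the density of the first coordinate.
\<close>

lemma unit_ball_vol_Suc:
  "unit_ball_vol (real (Suc k)) = unit_ball_vol (real k) * slice_mass k"
proof -
  have "((\<lambda>t. 1 * slice_weight k t) has_integral slice_mass k) {-1..1}"
    unfolding slice_mass_def mult_1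
    by (intro integrable_integral integrable_continuous_interval continuous_intros)
  from nn_integral_unit_ball_first_coord[OF refl _ _ this]
  have "ennreal (unit_ball_vol (real (Suc k))) = ennreal (unit_ball_vol (real k) * slice_mass k)"
    by (simp add: emeasure_unit_ball)
  then show ?thesis using slice_mass_pos[of k]
    by (subst (asm) ennreal_inj) (auto intro!: mult_nonneg_nonneg)
qed

lemma nn_integral_mu_first_coord:
  assumes n: "n = Suc k" and f [measurable]: "f \<in> borel_measurable borel" and nonneg: "\<And>t. 0 \<le> f t"
    and J: "((\<lambda>t. f t * slice_weight k t) has_integral J) {-1..1}"
  shows "(\<integral>\<^sup>+y. ennreal (f (y 1)) \<partial>mu n (unit_ball n)) = ennreal (J / slice_mass k)"
proof -
  have J0: "0 \<le> J"
    using J by (rule has_integral_nonneg) (auto intro!: mult_nonneg_nonneg nonneg slice_weight_nonneg)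
  have "(\<integral>\<^sup>+y. ennreal (f (y 1)) \<partial>mu n (unit_ball n))
    = ennreal (unit_ball_vol (real k) * J) / ennreal (unit_ball_vol (real n))"
    unfolding mu_def nn_integral_unit_ball_first_coord[OF n f nonneg J, symmetric] emeasure_unit_ball[symmetric]
    using n by (intro nn_integral_uniform_measure sets_unit_ball measurable_compose[OF measurable_coord_Rn]) auto
  also have "\<dots> = ennreal (J / slice_mass k)"
    unfolding n unit_ball_vol_Suc using J0 slice_mass_pos[of k] unit_ball_vol_pos[of "real k"]
    by (subst divide_ennreal) (auto intro!: mult_nonneg_nonneg mult_pos_pos simp: less_imp_neq[symmetric])
  finally show ?thesis .
qed

lemma integral_exp_mu_first_coord:
  assumes n: "n = Suc k"
  shows "(\<integral>y. exp (s * y 1) \<partial>mu n (unit_ball n))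
    = integral {-1..1} (\<lambda>t. exp (s * t) * slice_weight k t) / slice_mass k"
proof -
  have J: "((\<lambda>t. exp (s * t) * slice_weight k t) has_integral
      integral {-1..1} (\<lambda>t. exp (s * t) * slice_weight k t)) {-1..1}"
    by (intro integrable_integral integrable_continuous_interval continuous_intros)
  have "0 \<le> integral {-1..1} (\<lambda>t. exp (s * t) * slice_weight k t)"
    using J by (rule has_integral_nonneg) (auto intro!: mult_nonneg_nonneg slice_weight_nonneg)
  moreover have "(\<lambda>y. exp (s * y 1)) \<in> borel_measurable (mu n (unit_ball n))"
    using measurable_coord_Rn[of 1 n] n by (simp cong: measurable_cong_sets)
  ultimately show ?thesis
    using nn_integral_mu_first_coord[OF n _ _ J] slice_mass_pos[of k]
    by (subst integral_eq_nn_integral) (auto simp: enn2real_ennreal)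
qed

definition cap :: "nat \<Rightarrow> real \<Rightarrow> (nat \<Rightarrow> real) set" where
  "cap n r = {y \<in> Rn n. r \<le> y 1}"

lemma sets_halfspace [measurable]: "{y \<in> Rn n. t \<le> inner_Rn n u y} \<in> sets (lebesgue_Rn n)"
proof -
  have "{y \<in> space (lebesgue_Rn n). t \<le> inner_Rn n u y} \<in> sets (lebesgue_Rn n)" by measurable
  then show ?thesis by simp
qed

lemma inner_e1: "1 \<le> n \<Longrightarrow> inner_Rn n (e1 n) y = y 1"
  by (simp add: inner_Rn_def e1_def if_distrib[of "\<lambda>c. c * _"] cong: if_cong)

lemma cap_eq_halfspace: "1 \<le> n \<Longrightarrow> cap n r = {y \<in> Rn n. r \<le> inner_Rn n (e1 n) y}"
  by (simp add: cap_def inner_e1)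

lemma measure_cap:
  assumes n: "n = Suc k" and r: "0 \<le> r" "r < 1"
  shows "measure (mu n (unit_ball n)) (cap n r) = integral {r..1} (slice_weight k) / slice_mass k"
proof -
  have J: "(slice_weight k has_integral integral {r..1} (slice_weight k)) {r..1}"
    by (intro integrable_integral integrable_continuous_interval continuous_intros)
  have "((\<lambda>t. if t \<in> {r..1} then slice_weight k t else 0) has_integral integral {r..1} (slice_weight k)) {-1..1}"
    using r by (subst has_integral_restrict) (auto intro: J)
  also have "?this \<longleftrightarrow> ((\<lambda>t. indicator {r..} t * slice_weight k t) has_integral integral {r..1} (slice_weight k)) {-1..1}"
    by (intro has_integral_cong) auto
  finally have *: "((\<lambda>t. indicator {r..} t * slice_weight k t) has_integral integral {r..1} (slice_weight k)) {-1..1}" .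
  have J0: "0 \<le> integral {r..1} (slice_weight k)"
    using J by (rule has_integral_nonneg) (use r in \<open>auto intro!: slice_weight_nonneg\<close>)
  have cap [measurable]: "cap n r \<in> sets (mu n (unit_ball n))"
    using n by (simp add: cap_eq_halfspace)
  have "emeasure (mu n (unit_ball n)) (cap n r) = (\<integral>\<^sup>+y. indicator (cap n r) y \<partial>mu n (unit_ball n))"
    by (rule nn_integral_indicator[symmetric]) (rule cap)
  also have "\<dots> = (\<integral>\<^sup>+y. ennreal (indicator {r..} (y 1)) \<partial>mu n (unit_ball n))"
    by (intro nn_integral_cong) (auto simp: cap_def indicator_def)
  also have "\<dots> = ennreal (integral {r..1} (slice_weight k) / slice_mass k)"
    by (rule nn_integral_mu_first_coord[OF n _ _ *]) auto
  finally show ?thesis using J0 slice_mass_pos[of k] by (simp add: measure_def)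
qed

section \<open>Symmetry under sign changes of the coordinates\<close>

definition sign_flip :: "nat \<Rightarrow> (nat \<Rightarrow> real) \<Rightarrow> (nat \<Rightarrow> real) \<Rightarrow> nat \<Rightarrow> real" where
  "sign_flip n \<sigma> y = (\<lambda>i\<in>{1..n}. \<sigma> i * y i)"

lemma measurable_sign_flip [measurable]: "sign_flip n \<sigma> \<in> measurable (lebesgue_Rn n) (lebesgue_Rn n)"
  unfolding sign_flip_def[abs_def] lebesgue_Rn_def by measurable

lemma sign_flip_in_Rn [simp]: "sign_flip n \<sigma> y \<in> Rn n"
  by (simp add: sign_flip_def Rn_def)

lemma distr_lebesgue_Rn_sign_flip:
  assumes \<sigma>: "\<And>i. \<bar>\<sigma> i\<bar> = 1"
  shows "distr (lebesgue_Rn n) (lebesgue_Rn n) (sign_flip n \<sigma>) = lebesgue_Rn n"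
proof -
  interpret product_sigma_finite "\<lambda>_::nat. lborel :: real measure" by standard
  interpret finite_product_sigma_finite "\<lambda>_::nat. lborel :: real measure" "{1..n}" by standard auto
  have one: "emeasure lborel ((\<lambda>x. \<sigma> i * x) -` A) = emeasure lborel A" if "A \<in> sets borel" for A :: "real set" and i
  proof -
    have "\<sigma> i \<noteq> 0" using \<sigma>[of i] by auto
    then have "distr lborel borel ((*) (\<sigma> i)) = (lborel :: real measure)"
      by (subst lborel_distr_mult) (simp_all add: \<sigma> density_1 flip: one_ennreal_def)
    then have "emeasure lborel A = emeasure (distr lborel borel ((*) (\<sigma> i))) A" by simp
    then show ?thesis using that by (simp add: emeasure_distr)
  qed
  show ?thesis unfolding lebesgue_Rn_def
  proof (rule PiM_eqI)
    fix A :: "nat \<Rightarrow> real set" assume A: "\<And>i. i \<in> {1..n} \<Longrightarrow> A i \<in> sets lborel"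
    have eq: "sign_flip n \<sigma> -` Pi\<^sub>E {1..n} A \<inter> space (Pi\<^sub>M {1..n} (\<lambda>_. lborel))
        = Pi\<^sub>E {1..n} (\<lambda>i. (\<lambda>x. \<sigma> i * x) -` A i)"
      by (auto simp: sign_flip_def space_PiM PiE_def Pi_def)
    have "emeasure (distr (Pi\<^sub>M {1..n} (\<lambda>_. lborel)) (Pi\<^sub>M {1..n} (\<lambda>_. lborel)) (sign_flip n \<sigma>)) (Pi\<^sub>E {1..n} A)
        = emeasure (Pi\<^sub>M {1..n} (\<lambda>_. lborel)) (Pi\<^sub>E {1..n} (\<lambda>i. (\<lambda>x. \<sigma> i * x) -` A i))"
      using A measurable_sign_flip[of n \<sigma>]
      by (subst emeasure_distr) (auto simp: eq lebesgue_Rn_def simp del: One_nat_def intro!: sets_PiM_I_finite)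
    also have "\<dots> = (\<Prod>i\<in>{1..n}. emeasure lborel ((\<lambda>x. \<sigma> i * x) -` A i))"
    proof (rule measure_times)
      fix i assume "i \<in> {1..n}"
      then have [measurable]: "A i \<in> sets borel" using A by simp
      have "(\<lambda>x. \<sigma> i * x) -` A i \<inter> space borel \<in> sets borel" by measurable
      then show "(\<lambda>x. \<sigma> i * x) -` A i \<in> sets lborel" by simp
    qed
    also have "\<dots> = (\<Prod>i\<in>{1..n}. emeasure lborel (A i))"
      using A by (intro prod.cong) (auto intro!: one)
    finally show "emeasure (distr (Pi\<^sub>M {1..n} (\<lambda>_. lborel)) (Pi\<^sub>M {1..n} (\<lambda>_. lborel)) (sign_flip n \<sigma>)) (Pi\<^sub>E {1..n} A)
      = (\<Prod>i\<in>{1..n}. emeasure lborel (A i))" .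
  qed auto
qed

lemma sign_flip_in_unit_ball:
  assumes \<sigma>: "\<And>i. \<bar>\<sigma> i\<bar> = 1" and y: "y \<in> Rn n"
  shows "sign_flip n \<sigma> y \<in> unit_ball n \<longleftrightarrow> y \<in> unit_ball n"
proof -
  have "(\<sigma> i)\<^sup>2 = 1" for i using \<sigma>[of i] by (metis one_power2 power2_abs)
  then have "L2_set (sign_flip n \<sigma> y) {1..n} = L2_set y {1..n}"
    unfolding L2_set_def by (intro arg_cong[of _ _ sqrt] sum.cong) (auto simp: sign_flip_def power_mult_distrib)
  then show ?thesis using y by (simp add: unit_ball_def)
qed

lemma distr_mu_sign_flip:
  assumes \<sigma>: "\<And>i. \<bar>\<sigma> i\<bar> = 1"
  shows "distr (mu n (unit_ball n)) (mu n (unit_ball n)) (sign_flip n \<sigma>) = mu n (unit_ball n)"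
proof (rule measure_eqI)
  fix A assume "A \<in> sets (distr (mu n (unit_ball n)) (mu n (unit_ball n)) (sign_flip n \<sigma>))"
  then have A [measurable]: "A \<in> sets (lebesgue_Rn n)" by simp
  have m: "sign_flip n \<sigma> \<in> measurable (mu n (unit_ball n)) (mu n (unit_ball n))"
    using measurable_sign_flip[of n \<sigma>] by (simp cong: measurable_cong_sets)
  have P: "sign_flip n \<sigma> -` A \<inter> Rn n \<in> sets (lebesgue_Rn n)"
    using measurable_sets[OF measurable_sign_flip A, of \<sigma>] by simp
  have eq: "unit_ball n \<inter> (sign_flip n \<sigma> -` A \<inter> Rn n) = sign_flip n \<sigma> -` (unit_ball n \<inter> A) \<inter> Rn n"
    using sign_flip_in_unit_ball[OF \<sigma>] by (auto simp: unit_ball_def)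
  have "emeasure (lebesgue_Rn n) (unit_ball n \<inter> (sign_flip n \<sigma> -` A \<inter> Rn n))
      = emeasure (distr (lebesgue_Rn n) (lebesgue_Rn n) (sign_flip n \<sigma>)) (unit_ball n \<inter> A)"
    unfolding eq by (subst emeasure_distr) auto
  then have "emeasure (mu n (unit_ball n)) (sign_flip n \<sigma> -` A \<inter> Rn n) = emeasure (mu n (unit_ball n)) A"
    by (simp add: emeasure_mu P A distr_lebesgue_Rn_sign_flip[OF \<sigma>])
  then show "emeasure (distr (mu n (unit_ball n)) (mu n (unit_ball n)) (sign_flip n \<sigma>)) A
    = emeasure (mu n (unit_ball n)) A"
    using m A by (subst emeasure_distr) auto
qed simp

lemma measure_mu_sign_flip:
  assumes \<sigma>: "\<And>i. \<bar>\<sigma> i\<bar> = 1" and A: "A \<in> sets (lebesgue_Rn n)"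
  shows "measure (mu n (unit_ball n)) (sign_flip n \<sigma> -` A \<inter> Rn n) = measure (mu n (unit_ball n)) A"
proof -
  have m: "sign_flip n \<sigma> \<in> measurable (mu n (unit_ball n)) (mu n (unit_ball n))"
    using measurable_sign_flip[of n \<sigma>] by (simp cong: measurable_cong_sets)
  show ?thesis
    using measure_distr[OF m, of A] A by (simp add: distr_mu_sign_flip[OF \<sigma>])
qed

abbreviation axis_sign :: "nat \<Rightarrow> real" where
  "axis_sign i \<equiv> (if i = 1 then 1 else - 1)"

text \<open>
  The reflection in the first axis changes the sign of everything in \<open>\<langle>u, y\<rangle>\<close> except the
  contribution of the first coordinate.
\<close>

lemma inner_flip_axis:
  assumes "1 \<le> n"
  shows "inner_Rn n u y + inner_Rn n u (sign_flip n axis_sign y) = 2 * (u 1 * y 1)"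
proof -
  have "inner_Rn n u y + inner_Rn n u (sign_flip n axis_sign y)
      = (\<Sum>i\<in>{1..n}. if i = 1 then 2 * (u i * y i) else 0)"
    unfolding inner_Rn_def sum.distrib[symmetric] by (intro sum.cong) (auto simp: sign_flip_def)
  then show ?thesis using assms by simp
qed

lemma inner_scale_e1: "1 \<le> n \<Longrightarrow> inner_Rn n u (scale_Rn n r (e1 n)) = u 1 * r"
proof -
  assume n: "1 \<le> n"
  have "inner_Rn n u (scale_Rn n r (e1 n)) = (\<Sum>i\<in>{1..n}. if i = 1 then u i * r else 0)"
    unfolding inner_Rn_def by (intro sum.cong) (auto simp: scale_Rn_def e1_def)
  then show ?thesis using n by simp
qed

section \<open>Reduction of the depth to a cap\<close>

text \<open>
  For a half-space \<open>H = {y. \<langle>u, y\<rangle> \<ge> t}\<close> containing \<open>r e\<^sub>1\<close>, a point \<open>y\<close> with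
  \<open>u\<^sub>1 y\<^sub>1 \<ge> u\<^sub>1 r\<close> lies in \<open>H\<close> or has its reflection in the first axis in \<open>H\<close>, because the two
  inner products have mean \<open>u\<^sub>1 y\<^sub>1 \<ge> t\<close>.  Those points therefore have measure at most
  \<open>2 \<mu> H\<close>, and they include the cap if \<open>u\<^sub>1 \<ge> 0\<close> and the opposite cap, of
  the same measure, otherwise.
\<close>

lemma measure_cap_le_halfspace:
  assumes n: "1 \<le> n" and r: "0 \<le> r" and t: "t \<le> u 1 * r"
  shows "measure (mu n (unit_ball n)) (cap n r)
    \<le> 2 * measure (mu n (unit_ball n)) {y \<in> Rn n. t \<le> inner_Rn n u y}"
proof -
  let ?M = "mu n (unit_ball n)"
  interpret finite_measure ?M by (rule finite_measure_mu)
  define H where "H = {y \<in> Rn n. t \<le> inner_Rn n u y}"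
  define P where "P = {y \<in> Rn n. u 1 * r \<le> u 1 * y 1}"
  have H: "H \<in> sets (lebesgue_Rn n)" unfolding H_def by (rule sets_halfspace)
  have P: "P \<in> sets (lebesgue_Rn n)"
  proof -
    have "{y \<in> space (lebesgue_Rn n). u 1 * r \<le> u 1 * y 1} \<in> sets (lebesgue_Rn n)"
    proof -
      have [measurable]: "(\<lambda>y. y 1) \<in> borel_measurable (lebesgue_Rn n)"
        using n by (intro measurable_coord_Rn) auto
      show ?thesis by measurable
    qed
    then show ?thesis by (simp add: P_def)
  qed
  have fm: "sign_flip n \<sigma> -` A \<inter> Rn n \<in> sets (lebesgue_Rn n)" if "A \<in> sets (lebesgue_Rn n)" for A \<sigma>
    using measurable_sets[OF measurable_sign_flip that, of \<sigma>] by simp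
  have "measure ?M (cap n r) \<le> measure ?M P"
  proof (cases "0 \<le> u 1")
    case True
    then have "cap n r \<subseteq> P" by (auto simp: cap_def P_def intro: mult_left_mono)
    then show ?thesis using P by (intro finite_measure_mono) auto
  next
    case False
    have "cap n r \<subseteq> sign_flip n (\<lambda>_. - 1) -` P \<inter> Rn n"
    proof
      fix y assume y: "y \<in> cap n r"
      then have "u 1 * r \<le> u 1 * (- y 1)"
        using False r by (intro mult_left_mono_neg) (auto simp: cap_def)
      then show "y \<in> sign_flip n (\<lambda>_. - 1) -` P \<inter> Rn n"
        using y n by (auto simp: P_def cap_def) (auto simp: sign_flip_def)
    qed
    then have "measure ?M (cap n r) \<le> measure ?M (sign_flip n (\<lambda>_. - 1) -` P \<inter> Rn n)"
      using fm[OF P] by (intro finite_measure_mono) auto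
    then show ?thesis using measure_mu_sign_flip[of "\<lambda>_. - 1" P n] P by simp
  qed
  also have "P \<subseteq> H \<union> (sign_flip n axis_sign -` H \<inter> Rn n)"
  proof
    fix y assume "y \<in> P"
    then have y: "y \<in> Rn n" "2 * t \<le> 2 * (u 1 * y 1)" using t by (auto simp: P_def)
    then have "t \<le> inner_Rn n u y \<or> t \<le> inner_Rn n u (sign_flip n axis_sign y)"
      unfolding inner_flip_axis[OF n, symmetric] by linarith
    then show "y \<in> H \<union> (sign_flip n axis_sign -` H \<inter> Rn n)" using y by (auto simp: H_def)
  qed
  then have "measure ?M P \<le> measure ?M (H \<union> (sign_flip n axis_sign -` H \<inter> Rn n))"
    using H fm[OF H] by (intro finite_measure_mono) auto
  also have "\<dots> \<le> measure ?M H + measure ?M (sign_flip n axis_sign -` H \<inter> Rn n)"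
    using H fm[OF H] by (intro measure_Un_le) auto
  also have "\<dots> = 2 * measure ?M H" using measure_mu_sign_flip[of axis_sign H n] H by simp
  finally show ?thesis by (simp add: H_def)
qed

lemma tukey_depth_unit_ball_bounds:
  assumes n: "1 \<le> n" and r: "0 \<le> r"
  shows "measure (mu n (unit_ball n)) (cap n r) / 2 \<le> tukey_depth n (unit_ball n) (scale_Rn n r (e1 n))"
    and "tukey_depth n (unit_ball n) (scale_Rn n r (e1 n)) \<le> measure (mu n (unit_ball n)) (cap n r)"
proof -
  let ?x = "scale_Rn n r (e1 n)"
  have e1: "e1 n \<in> Rn n" "e1 n \<noteq> zero_Rn n" "e1 n 1 = 1"
  proof -
    show "e1 n \<in> Rn n" by (simp add: e1_def Rn_def)
    show "e1 n 1 = 1" using n by (simp add: e1_def)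
    moreover have "zero_Rn n 1 = 0" using n by (simp add: zero_Rn_def)
    ultimately show "e1 n \<noteq> zero_Rn n" by auto
  qed
  have x: "?x \<in> Rn n" by (simp add: scale_Rn_def Rn_def)
  have cap: "cap n r \<in> {H. closed_halfspace n H \<and> ?x \<in> H}"
    using n e1 x inner_scale_e1[OF n, of "e1 n" r]
    by (auto simp: closed_halfspace_def cap_eq_halfspace)
  show "tukey_depth n (unit_ball n) ?x \<le> measure (mu n (unit_ball n)) (cap n r)"
    unfolding tukey_depth_def by (rule cINF_lower[OF _ cap]) (auto intro: bdd_belowI[of _ 0])
  show "measure (mu n (unit_ball n)) (cap n r) / 2 \<le> tukey_depth n (unit_ball n) ?x"
    unfolding tukey_depth_def
  proof (rule cINF_greatest)
    fix H assume "H \<in> {H. closed_halfspace n H \<and> ?x \<in> H}"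
    then obtain u t where H: "H = {y \<in> Rn n. t \<le> inner_Rn n u y}" "t \<le> u 1 * r"
      using inner_scale_e1[OF n] by (auto simp: closed_halfspace_def)
    then show "measure (mu n (unit_ball n)) (cap n r) / 2 \<le> measure (mu n (unit_ball n)) H"
      using measure_cap_le_halfspace[OF n r, of t u] by simp
  qed (use cap in auto)
qed

section \<open>Reduction of the Cramer transform to one variable\<close>

lemma integrable_exp_inner_mu:
  "integrable (mu n (unit_ball n)) (\<lambda>y. exp (inner_Rn n \<theta> y))"
proof -
  interpret finite_measure "mu n (unit_ball n)" by (rule finite_measure_mu)
  have bound: "inner_Rn n \<theta> y \<le> L2_set \<theta> {1..n}" if "y \<in> unit_ball n" for y
  proof -
    have "inner_Rn n \<theta> y \<le> (\<Sum>i\<in>{1..n}. \<bar>\<theta> i\<bar> * \<bar>y i\<bar>)"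
      unfolding inner_Rn_def by (intro sum_mono) (metis abs_ge_self abs_mult)
    also have "\<dots> \<le> L2_set \<theta> {1..n} * L2_set y {1..n}" by (rule L2_set_mult_ineq)
    also have "\<dots> \<le> L2_set \<theta> {1..n} * 1"
      using that by (intro mult_left_mono) (auto simp: unit_ball_def)
    finally show ?thesis by simp
  qed
  have "AE y in mu n (unit_ball n). norm (exp (inner_Rn n \<theta> y)) \<le> exp (L2_set \<theta> {1..n})"
    unfolding mu_def by (rule AE_uniform_measureI) (auto intro!: AE_I2 bound simp del: One_nat_def)
  then show ?thesis
    by (rule integrable_const_bound) measurable
qed

text \<open>
  Averaging the integrand with its reflection in the first axis replaces \<open>exp (p + q)\<close> by
  \<open>exp p \<cdot> (exp q + exp (- q)) / 2 \<ge> exp p\<close>, where \<open>p\<close> is the contribution of the first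
  coordinate.
\<close>

lemma mgf_unit_ball_ge_axis:
  assumes n: "1 \<le> n"
  shows "(\<integral>y. exp (\<theta> 1 * y 1) \<partial>mu n (unit_ball n)) \<le> (\<integral>y. exp (inner_Rn n \<theta> y) \<partial>mu n (unit_ball n))"
proof -
  let ?M = "mu n (unit_ball n)" and ?F = "sign_flip n axis_sign"
  have m: "?F \<in> measurable ?M ?M"
    using measurable_sign_flip[of n axis_sign] by (simp cong: measurable_cong_sets)
  have M: "distr ?M ?M ?F = ?M" by (rule distr_mu_sign_flip) auto
  have meas: "(\<lambda>y. exp (inner_Rn n \<theta> y)) \<in> borel_measurable ?M" by measurable
  have I: "(\<integral>y. exp (inner_Rn n \<theta> (?F y)) \<partial>?M) = (\<integral>y. exp (inner_Rn n \<theta> y) \<partial>?M)"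
    using integral_distr[OF m meas] M by simp
  have i1: "integrable ?M (\<lambda>y. exp (inner_Rn n \<theta> (?F y)))"
    using integrable_distr_eq[OF m meas] integrable_exp_inner_mu[of n \<theta>] M by simp
  have "inner_Rn n (\<lambda>i. \<theta> 1 * e1 n i) y = \<theta> 1 * inner_Rn n (e1 n) y" for y
    by (simp add: inner_Rn_def sum_distrib_left mult.assoc)
  then have i2: "integrable ?M (\<lambda>y. exp (\<theta> 1 * y 1))"
    using integrable_exp_inner_mu[of n "\<lambda>i. \<theta> 1 * e1 n i"] by (simp only: inner_e1[OF n])
  have "2 * (\<integral>y. exp (\<theta> 1 * y 1) \<partial>?M) = (\<integral>y. 2 * exp (\<theta> 1 * y 1) \<partial>?M)" by simp
  also have "\<dots> \<le> (\<integral>y. exp (inner_Rn n \<theta> y) + exp (inner_Rn n \<theta> (?F y)) \<partial>?M)"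
  proof (rule integral_mono)
    fix y :: "nat \<Rightarrow> real"
    define p where "p = \<theta> 1 * y 1"
    define q where "q = inner_Rn n \<theta> y - p"
    have "inner_Rn n \<theta> (?F y) = p + - q" "inner_Rn n \<theta> y = p + q"
      using inner_flip_axis[OF n, of \<theta> y] by (simp_all add: p_def q_def)
    then have "exp (inner_Rn n \<theta> y) + exp (inner_Rn n \<theta> (?F y)) = exp p * (exp q + exp (- q))"
      by (simp only: exp_add distrib_left)
    moreover have "2 \<le> exp q + exp (- q)"
      using exp_ge_add_one_self[of q] exp_ge_add_one_self[of "- q"] by linarith
    then have "exp p * 2 \<le> exp p * (exp q + exp (- q))" by (intro mult_left_mono) auto
    ultimately show "2 * exp (\<theta> 1 * y 1) \<le> exp (inner_Rn n \<theta> y) + exp (inner_Rn n \<theta> (?F y))"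
      unfolding p_def[symmetric] by linarith
  qed (intro Bochner_Integration.integrable_add integrable_mult_right i1 i2 integrable_exp_inner_mu)+
  also have "\<dots> = 2 * (\<integral>y. exp (inner_Rn n \<theta> y) \<partial>?M)"
    unfolding Bochner_Integration.integral_add[OF integrable_exp_inner_mu i1] I by simp
  finally show ?thesis by simp
qed

text \<open>
  Since \<open>\<langle>\<theta>, r e\<^sub>1\<rangle>\<close> depends on \<open>\<theta>\<^sub>1\<close> only, moving \<open>\<theta>\<close> onto the first axis can only increase
  the expression in the supremum.  So the supremum is governed by the one-parameter family
  \<open>exp (- s r) \<cdot> M(s e\<^sub>1)\<close>: a lower bound for all \<open>s\<close> and an upper bound for one \<open>s\<^sub>0\<close> suffice.  They
  also show that the supremum is finite, so the extended exponential takes a real value.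
\<close>

lemma exp_neg_cramer_bounds:
  assumes n: "1 \<le> n" and a: "0 < a"
    and lower: "\<And>s. a \<le> exp (- (s * r)) * (\<integral>y. exp (s * y 1) \<partial>mu n (unit_ball n))"
    and upper: "exp (- (s0 * r)) * (\<integral>y. exp (s0 * y 1) \<partial>mu n (unit_ball n)) \<le> b"
  obtains E where "exp_ereal (- cramer n (unit_ball n) (scale_Rn n r (e1 n))) = ereal E" "a \<le> E" "E \<le> b"
proof -
  let ?M = "\<lambda>\<theta>. \<integral>y. exp (inner_Rn n \<theta> y) \<partial>mu n (unit_ball n)"
  let ?x = "scale_Rn n r (e1 n)"
  let ?\<Lambda> = "cramer n (unit_ball n) ?x"
  have "?\<Lambda> \<le> ereal (- ln a)"
    unfolding cramer_def
  proof (rule SUP_least)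
    fix \<theta> assume "\<theta> \<in> Rn n"
    have "a \<le> exp (- (\<theta> 1 * r)) * (\<integral>y. exp (\<theta> 1 * y 1) \<partial>mu n (unit_ball n))" by (rule lower)
    also have "\<dots> \<le> exp (- (\<theta> 1 * r)) * ?M \<theta>" by (intro mult_left_mono mgf_unit_ball_ge_axis n) auto
    finally have *: "a \<le> exp (- (\<theta> 1 * r)) * ?M \<theta>" .
    then have "0 < ?M \<theta>" using a by (smt (verit) exp_gt_zero zero_less_mult_pos)
    then have "ln a \<le> - (\<theta> 1 * r) + ln (?M \<theta>)"
      using * a by (metis exp_gt_zero ln_exp ln_mono ln_mult_pos)
    then show "ereal (inner_Rn n \<theta> ?x - ln (?M \<theta>)) \<le> ereal (- ln a)"
      by (simp add: inner_scale_e1[OF n])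
  qed
  moreover have "ereal (- ln b) \<le> ?\<Lambda>"
    unfolding cramer_def
  proof (rule SUP_upper2)
    let ?\<theta> = "scale_Rn n s0 (e1 n)"
    show "?\<theta> \<in> Rn n" by (simp add: scale_Rn_def Rn_def)
    have t: "?\<theta> 1 = s0" using n by (simp add: scale_Rn_def e1_def)
    have "inner_Rn n ?\<theta> y = s0 * y 1" for y
      using inner_scale_e1[OF n, of y s0] by (simp add: inner_Rn_def mult.commute)
    then have M: "?M ?\<theta> = (\<integral>y. exp (s0 * y 1) \<partial>mu n (unit_ball n))" by simp
    have "0 < exp (- (s0 * r)) * ?M ?\<theta>" using lower[of s0] a M by simp
    then have pos: "0 < ?M ?\<theta>" by (simp add: zero_less_mult_iff)
    then have "- (s0 * r) + ln (?M ?\<theta>) = ln (exp (- (s0 * r)) * ?M ?\<theta>)"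
      by (simp add: ln_mult_pos)
    also have "\<dots> \<le> ln b" using upper pos unfolding M by (intro ln_mono) auto
    finally show "ereal (- ln b) \<le> ereal (inner_Rn n ?\<theta> ?x - ln (?M ?\<theta>))"
      unfolding inner_scale_e1[OF n] t by simp
  qed
  ultimately obtain L where L: "?\<Lambda> = ereal L" "- ln b \<le> L" "L \<le> - ln a"
    by (cases ?\<Lambda>) auto
  have "0 < b" using lower[of s0] upper a by linarith
  show ?thesis
  proof
    show "exp_ereal (- ?\<Lambda>) = ereal (exp (- L))" by (simp add: L exp_ereal_def)
    have "exp (ln a) \<le> exp (- L)" "exp (- L) \<le> exp (ln b)" using L by auto
    then show "a \<le> exp (- L)" "exp (- L) \<le> b" using a \<open>0 < b\<close> by auto
  qed
qed

section \<open>Comparison of the depth with the Cramer transform\<close>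

lemma tilted_mgf_eq:
  assumes n: "n = Suc k"
  shows "exp (- (s * r)) * (\<integral>y. exp (s * y 1) \<partial>mu n (unit_ball n))
    = integral {-1..1} (\<lambda>t. exp (s * (t - r)) * slice_weight k t) / slice_mass k"
proof -
  have eq: "exp (s * (t - r)) = exp (- (s * r)) * exp (s * t)" for t
    by (simp add: algebra_simps flip: exp_add)
  show ?thesis
    unfolding integral_exp_mu_first_coord[OF n] eq by (simp add: mult.assoc)
qed

theorem proposition4p2:
  fixes r :: real
  assumes "0 < r" and "r < 1"
  shows "\<exists>c1 c2 :: real. c1 > 0 \<and> c2 > 0 \<and>
    (\<forall>n\<ge>1.
       ereal (c1 / sqrt (real n)) * exp_ereal (- cramer n (unit_ball n) (scale_Rn n r (e1 n)))
         \<le> ereal (tukey_depth n (unit_ball n) (scale_Rn n r (e1 n))) \<and>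
       ereal (tukey_depth n (unit_ball n) (scale_Rn n r (e1 n)))
         \<le> ereal (c2 / sqrt (real n)) * exp_ereal (- cramer n (unit_ball n) (scale_Rn n r (e1 n))))"
proof -
  define d where "d = 1 - r\<^sup>2"
  define c0 where "c0 = exp (- (1 / 2 :: real)) / 3"
  define C0 where "C0 = exp 2 * pi * sqrt 2"
  have pos: "0 < d" "0 < c0" "0 < C0"
    using assms by (auto simp: d_def c0_def C0_def abs_square_less_1)
  show ?thesis
  proof (intro exI conjI allI impI)
    \<comment> \<open>The factor \<open>4\<close> is the \<open>2\<close> lost to the reflection times the \<open>2\<close> from \<open>k + 2 \<le> 2 n\<close>.\<close>
    show "0 < d * c0 / (4 * C0\<^sup>2)" "0 < C0 / (r * c0\<^sup>2)" using pos assms by auto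
    fix n :: nat assume n1: "1 \<le> n"
    define k where "k = n - 1"
    have n: "n = Suc k" using n1 by (simp add: k_def)
    define S where "S = sqrt (real n)"
    define W where "W = slice_weight k r"
    define m where "m = slice_mass k"
    define G where "G = measure (mu n (unit_ball n)) (cap n r)"
    define q where "q = tukey_depth n (unit_ball n) (scale_Rn n r (e1 n))"
    have r: "0 \<le> r" "r < 1" using assms by auto
    have S: "0 < S" "S * S = real n" using n by (auto simp: S_def)
    have W: "0 < W" unfolding W_def using assms by (intro slice_weight_pos) auto
    have m: "c0 / S \<le> m" "m \<le> C0 / S" "0 < m"
      using slice_mass_ge[OF n] slice_mass_le[OF n] slice_mass_pos[of k]
      by (auto simp: c0_def C0_def S_def m_def)
    have lower: "d * c0 * W / C0 \<le> exp (- (s * r)) * (\<integral>y. exp (s * y 1) \<partial>mu n (unit_ball n))" for s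
    proof -
      have "d * c0 * W / C0 = (d * c0 * W / S) / (C0 / S)" using S by simp
      also have "\<dots> \<le> (d * c0 * W / S) / m"
        using m pos S W by (intro divide_left_mono) auto
      also have "\<dots> \<le> integral {-1..1} (\<lambda>t. exp (s * (t - r)) * slice_weight k t) / m"
        using integral_exp_slice_weight_ge[OF r n, of s] m
        by (intro divide_right_mono) (auto simp: d_def c0_def W_def S_def)
      finally show ?thesis unfolding tilted_mgf_eq[OF n] m_def .
    qed
    define s0 where "s0 = real k * (r / (1 - r\<^sup>2))"
    have upper: "exp (- (s0 * r)) * (\<integral>y. exp (s0 * y 1) \<partial>mu n (unit_ball n)) \<le> C0 * W / c0"
    proof -
      have "integral {-1..1} (\<lambda>t. exp (s0 * (t - r)) * slice_weight k t) / m \<le> (C0 * W / S) / m"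
        using integral_exp_slice_weight_le[OF r n] m
        by (intro divide_right_mono) (auto simp: C0_def W_def S_def s0_def)
      also have "\<dots> \<le> (C0 * W / S) / (c0 / S)"
        using m pos S W by (intro divide_left_mono) auto
      also have "\<dots> = C0 * W / c0" using S by simp
      finally show ?thesis unfolding tilted_mgf_eq[OF n] m_def .
    qed
    obtain E where E: "exp_ereal (- cramer n (unit_ball n) (scale_Rn n r (e1 n))) = ereal E"
      "d * c0 * W / C0 \<le> E" "E \<le> C0 * W / c0"
      using exp_neg_cramer_bounds[OF n1 _ lower upper] pos W by auto
    have G: "G = integral {r..1} (slice_weight k) / m"
      unfolding G_def m_def by (rule measure_cap[OF n r])
    have "d * W / (2 * real n) \<le> d * W / real (k + 2)"
      using pos W n by (intro divide_left_mono) auto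
    also have "\<dots> \<le> integral {r..1} (slice_weight k)"
      using integral_cap_ge[OF r] by (simp add: d_def W_def)
    finally have cap: "d * W / (2 * real n) \<le> integral {r..1} (slice_weight k)" .
    moreover have "0 \<le> d * W / (2 * real n)" using pos W by simp
    ultimately have "d * W / (2 * real n) / (C0 / S) \<le> G"
      unfolding G using m by (intro frac_le) auto
    then have G1: "d * W / (2 * C0 * S) \<le> G"
      unfolding S(2)[symmetric] using S(1) by (simp add: mult_ac)
    have "integral {r..1} (slice_weight k) \<le> d * W / real (k + 2) / r"
      using integral_cap_le[OF assms] by (simp add: d_def W_def)
    also have "\<dots> \<le> d * W / real n / r"
      using pos W n assms by (intro divide_right_mono divide_left_mono) auto
    finally have "G \<le> d * W / real n / r / (c0 / S)"
      unfolding G using m pos W S assms by (intro frac_le) auto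
    then have G2: "G \<le> d * W / (r * c0 * S)"
      unfolding S(2)[symmetric] using S(1) by (simp add: mult_ac)
    have q: "G / 2 \<le> q" "q \<le> G"
      unfolding G_def q_def using tukey_depth_unit_ball_bounds[OF n1 r(1)] by auto
    have "d * c0 / (4 * C0\<^sup>2) / S * E \<le> d * c0 / (4 * C0\<^sup>2) / S * (C0 * W / c0)"
      using E pos S by (intro mult_left_mono) auto
    also have "\<dots> = d * W / (2 * C0 * S) / 2" using pos by (simp add: power2_eq_square)
    also have "\<dots> \<le> q" by (rule order_trans[OF divide_right_mono[OF G1] q(1)]) simp
    finally have 1: "d * c0 / (4 * C0\<^sup>2) / S * E \<le> q" .
    have "q \<le> d * W / (r * c0 * S)" using G2 q by linarith
    also have "\<dots> = C0 / (r * c0\<^sup>2) / S * (d * c0 * W / C0)" using pos by (simp add: power2_eq_square)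
    also have "\<dots> \<le> C0 / (r * c0\<^sup>2) / S * E"
      using E pos S assms by (intro mult_left_mono) auto
    finally have 2: "q \<le> C0 / (r * c0\<^sup>2) / S * E" .
    show "ereal (d * c0 / (4 * C0\<^sup>2) / sqrt (real n)) * exp_ereal (- cramer n (unit_ball n) (scale_Rn n r (e1 n)))
         \<le> ereal (tukey_depth n (unit_ball n) (scale_Rn n r (e1 n)))"
      using 1 by (simp add: E(1) q_def S_def)
    show "ereal (tukey_depth n (unit_ball n) (scale_Rn n r (e1 n)))
         \<le> ereal (C0 / (r * c0\<^sup>2) / sqrt (real n)) * exp_ereal (- cramer n (unit_ball n) (scale_Rn n r (e1 n)))"
      using 2 by (simp add: E(1) q_def S_def)
  qed
qed

end
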